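(* Let $\Phi:\mathbb{R}\to\mathbb{R}^3$, $u\mapsto\Phi(u)$, be a three-dimensional flux that is independent of the point $x$ (in a neighborhood of $\mathbb{S}^2$), and define the flux vector $F(x,u)=n(x)\times\Phi(u)$ for $x\in\mathbb{S}^2$, $u\in\mathbb{R}$. Then $F$ is geometry-compatible, that is, for every fixed $v\in\mathbb{R}$, $$\nabla_T\cdot F(x,v)=0\qquad\text{for all }x\in\mathbb{S}^2 .$$
   Context: $\mathbb{S}^2=\{x=(x_1,x_2,x_3)\in\mathbb{R}^3: x_1^2+x_2^2+x_3^2=1\}$ is the unit sphere, $n(x)$ is the outward unit normal to $\mathbb{S}^2$ at $x$ (so $n(x)=x$), and $\times$ is the cross product in $\mathbb{R}^3$. A flux vector is a family $F(\cdot,u)$ of tangent vector fields on $\mathbb{S}^2$ depending on a real parameter $u$. $\nabla_T\cdot$ denotes the tangential (Riemannian) divergence on $\mathbb{S}^2$ with its standard round metric; in longitude $\lambda$ and latitude $\phi$ (so $x=(\cos\phi\cos\lambda,\cos\phi\sin\lambda,\sin\phi)$), for a tangent field $F=F_\lambda i_\lambda+F_\phi i_\phi$ with $i_\lambda=(-\sin\lambda,\cos\lambda,0)$ and $i_\phi=(-\sin\phi\cos\lambda,-\sin\phi\sin\lambda,\cos\phi)$, one has $\nabla_T\cdot F=\frac{1}{\cos\phi}\left(\frac{\partial}{\partial\phi}(F_\phi\cos\phi)+\frac{\partial}{\partial\lambda}F_\lambda\right)$ away from the poles. In "$\nabla_T\cdot F(x,v)$" the parameter $v$ is held fixed and only $x$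 is differentiated. *)

theory Defs
  imports "HOL-Analysis.Analysis"
begin

unbundle cross3_syntax

abbreviation unit_sphere :: "(real^3) set"
  where "unit_sphere \<equiv> sphere 0 1"

definition outward_normal :: "real^3 \<Rightarrow> real^3"
  where "outward_normal x = x"

definition tangent_space :: "real^3 \<Rightarrow> (real^3) set"
  where "tangent_space x = {w. w \<bullet> outward_normal x = 0}"

definition tangent_proj :: "real^3 \<Rightarrow> real^3 \<Rightarrow> real^3"
  where "tangent_proj x w = w - (w \<bullet> outward_normal x) *\<^sub>R outward_normal x"

text \<open>
  The Levi-Civita connection of the round metric: the tangential part of the directional
  derivative in the ambient space. A derivative within the sphere is determined only on tangent
  directions, so the value is meaningful only for \<open>w \<in> tangent_space x\<close>
  (see \<open>covariant_deriv_eq\<close>).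
\<close>

definition covariant_deriv :: "(real^3 \<Rightarrow> real^3) \<Rightarrow> real^3 \<Rightarrow> real^3 \<Rightarrow> real^3"
  where "covariant_deriv X x w = tangent_proj x (frechet_derivative X (at x within unit_sphere) w)"

text \<open>
  The Riemannian divergence of \<open>X\<close> at \<open>x\<close> is the trace of the endomorphism
  \<open>w \<mapsto> covariant_deriv X x w\<close> of the tangent space. It is computed in \<open>\<real>\<^sup>3\<close> after extending the
  endomorphism by zero on the normal line, which does not change its trace. Agreement with
  the expression in longitude and latitude is \<open>tangential_div_coordinates\<close> below.
\<close>

definition tangential_div :: "(real^3 \<Rightarrow> real^3) \<Rightarrow> real^3 \<Rightarrow> real"
  where "tangential_div X x = trace (matrix (\<lambda>w. covariant_deriv X x (tangent_proj x w)))"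

definition flux_vector :: "(real^3 \<Rightarrow> real \<Rightarrow> real^3) \<Rightarrow> bool"
  where "flux_vector F \<longleftrightarrow> (\<forall>u. \<forall>x\<in>unit_sphere. F x u \<in> tangent_space x)"

text \<open>Differentiability is required so that the divergence is not a junk value.\<close>

definition geometry_compatible :: "(real^3 \<Rightarrow> real \<Rightarrow> real^3) \<Rightarrow> bool"
  where "geometry_compatible F \<longleftrightarrow>
    (\<forall>v. \<forall>x\<in>unit_sphere. (\<lambda>y. F y v) differentiable (at x within unit_sphere) \<and>
                          tangential_div (\<lambda>y. F y v) x = 0)"


lemma has_derivative_along_curve:
  assumes D: "(X has_derivative D) (at (c t) within unit_sphere)"
    and c: "(c has_vector_derivative w) (at t)" and S: "\<And>s. c s \<in> unit_sphere"
  shows "((\<lambda>s. X (c s)) has_vector_derivative D w) (at t)"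
proof -
  have "(X has_derivative D) (at (c t) within range c)"
    by (rule has_derivative_subset[OF D]) (use S in auto)
  then have "((X \<circ> c) has_derivative (D \<circ> (\<lambda>h. h *\<^sub>R w))) (at t)"
    using c diff_chain_within[of c "\<lambda>h. h *\<^sub>R w" t UNIV X D]
    by (simp add: has_vector_derivative_def)
  moreover have "D (h *\<^sub>R w) = h *\<^sub>R D w" for h
    using D has_derivative_bounded_linear bounded_linear.linear linear_scale by blast
  ultimately show ?thesis
    by (simp add: has_vector_derivative_def o_def)
qed

lemma derivative_unique_tangent:
  assumes "(X has_derivative D) (at x within unit_sphere)"
    and "(X has_derivative D') (at x within unit_sphere)"
    and x: "x \<in> unit_sphere" and w: "w \<in> tangent_space x"
  shows "D w = D' w"
proof -
  have unit: "D v = D' v" if v: "v \<bullet> x = 0" "v \<bullet> v = 1" for v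
  proof -
    define c where "c = (\<lambda>t::real. cos t *\<^sub>R x + sin t *\<^sub>R v)"
    have xx: "x \<bullet> x = 1"
      using x by (simp add: dot_square_norm)
    have "c s \<bullet> c s = 1" for s
      using v xx sin_cos_squared_add3[of s] by (simp add: c_def inner_simps inner_commute)
    then have S: "c s \<in> unit_sphere" for s
      by (simp add: norm_eq_sqrt_inner)
    have c: "(c has_vector_derivative v) (at 0)"
      unfolding c_def by (auto intro!: derivative_eq_intros)
    have "c 0 = x" by (simp add: c_def)
    then show ?thesis
      using has_derivative_along_curve[of X D c 0 v] has_derivative_along_curve[of X D' c 0 v]
        assms(1,2) c S vector_derivative_unique_at by metis
  qed
  have lin: "linear D" "linear D'"
    using assms(1,2) has_derivative_linear by auto
  show ?thesis
  proof (cases "w = 0")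
    case True
    then show ?thesis using lin by (simp add: linear_0)
  next
    case False
    have "D ((1 / norm w) *\<^sub>R w) = D' ((1 / norm w) *\<^sub>R w)"
      using w False
      by (intro unit) (auto simp: tangent_space_def outward_normal_def dot_square_norm power2_eq_square)
    then show ?thesis
      using lin False by (simp add: linear_scale)
  qed
qed

lemma covariant_deriv_eq:
  assumes D: "(X has_derivative D) (at x within unit_sphere)"
    and "x \<in> unit_sphere" and "w \<in> tangent_space x"
  shows "covariant_deriv X x w = tangent_proj x (D w)"
proof -
  have "(X has_derivative frechet_derivative X (at x within unit_sphere)) (at x within unit_sphere)"
    using D by (metis differentiableI frechet_derivative_works)
  then show ?thesis
    using assms derivative_unique_tangent by (metis covariant_deriv_def)
qed

definition sphere_point :: "real \<Rightarrow> real \<Rightarrow> real^3"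
  where "sphere_point l p = vector [cos p * cos l, cos p * sin l, sin p]"

definition i_lon :: "real \<Rightarrow> real^3"
  where "i_lon l = vector [- sin l, cos l, 0]"

definition i_lat :: "real \<Rightarrow> real \<Rightarrow> real^3"
  where "i_lat l p = vector [- sin p * cos l, - sin p * sin l, cos p]"

lemma tangential_div_frame:
  assumes D: "(X has_derivative D) (at (sphere_point l p) within unit_sphere)"
    and x: "sphere_point l p \<in> unit_sphere"
  shows "tangential_div X (sphere_point l p) = D (i_lon l) \<bullet> i_lon l + D (i_lat l p) \<bullet> i_lat l p"
proof -
  let ?x = "sphere_point l p" and ?e = "i_lon l" and ?f = "i_lat l p"
  have P: "tangent_proj ?x w = (w \<bullet> ?e) *\<^sub>R ?e + (w \<bullet> ?f) *\<^sub>R ?f" for w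
  proof -
    have "w$1 - (w$1*(cos p * cos l) + w$2*(cos p * sin l) + w$3* sin p) * (cos p * cos l)
        = (w$2* cos l - w$1* sin l) * (-sin l) + (-(w$1*(sin p * cos l)) - w$2*(sin p * sin l) + w$3* cos p) * (-sin p * cos l)"
      "w$2 - (w$1*(cos p * cos l) + w$2*(cos p * sin l) + w$3* sin p) * (cos p * sin l)
        = (w$2* cos l - w$1* sin l) * (cos l) + (-(w$1*(sin p * cos l)) - w$2*(sin p * sin l) + w$3* cos p) * (-sin p * sin l)"
      "w$3 - (w$1*(cos p * cos l) + w$2*(cos p * sin l) + w$3* sin p)* sin p
        = (-(w$1*(sin p * cos l)) - w$2*(sin p * sin l) + w$3* cos p)* cos p"
      using sin_cos_squared_add3[of l] sin_cos_squared_add3[of p] by algebra+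
    then show ?thesis
      by (simp add: tangent_proj_def outward_normal_def sphere_point_def i_lon_def i_lat_def
          vec_eq_iff forall_3 inner_vec_def sum_3 algebra_simps)
  qed
  have ef: "?e \<bullet> ?x = 0" "?f \<bullet> ?x = 0"
    by (simp_all add: sphere_point_def i_lon_def i_lat_def inner_vec_def sum_3 algebra_simps)
      (use sin_cos_squared_add3[of l] in algebra)
  have lin: "linear D" using D has_derivative_linear by auto
  have Px: "tangent_proj ?x w \<in> tangent_space ?x" for w
    using ef by (simp add: P tangent_space_def outward_normal_def inner_simps)
  have "covariant_deriv X ?x (tangent_proj ?x w) = tangent_proj ?x (D (tangent_proj ?x w))" for w
    using covariant_deriv_eq[OF D x Px] .
  also have "\<dots> w = (w \<bullet> ?e) *\<^sub>R tangent_proj ?x (D ?e) + (w \<bullet> ?f) *\<^sub>R tangent_proj ?x (D ?f)" for w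
    by (simp add: P[of w] linear_add[OF lin] linear_scale[OF lin])
      (simp add: tangent_proj_def inner_simps algebra_simps)
  finally have "tangential_div X ?x = ?e \<bullet> tangent_proj ?x (D ?e) + ?f \<bullet> tangent_proj ?x (D ?f)"
    by (simp add: tangential_div_def trace_def matrix_def inner_vec_def[of ?e] inner_vec_def[of ?f]
        inner_axis' sum.distrib)
  also have "\<dots> = D ?e \<bullet> ?e + D ?f \<bullet> ?f"
    using ef by (simp add: tangent_proj_def outward_normal_def inner_simps inner_commute)
  finally show ?thesis .
qed

proposition tangential_div_coordinates:
  assumes diff: "X differentiable (at (sphere_point l p) within unit_sphere)"
    and tangent: "\<And>x. x \<in> unit_sphere \<Longrightarrow> X x \<in> tangent_space x"
    and p: "cos p \<noteq> 0"
  shows "tangential_div X (sphere_point l p) =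
    1 / cos p * (deriv (\<lambda>q. (X (sphere_point l q) \<bullet> i_lat l q) * cos q) p +
                 deriv (\<lambda>k. X (sphere_point k p) \<bullet> i_lon k) l)"
proof -
  let ?x = "sphere_point l p" and ?e = "i_lon l" and ?f = "i_lat l p"
  obtain D where D: "(X has_derivative D) (at ?x within unit_sphere)"
    using diff by (auto simp: differentiable_def)
  have S: "sphere_point k q \<in> unit_sphere" for k q
  proof -
    have "(cos q * cos k)\<^sup>2 + (cos q * sin k)\<^sup>2 + (sin q)\<^sup>2 = 1"
      using sin_cos_squared_add3[of k] sin_cos_squared_add3[of q] by algebra
    then show ?thesis
      by (simp add: norm_eq_sqrt_inner inner_vec_def sum_3 sphere_point_def power2_eq_square)
  qed
  have vec: "vector [a, b, c] = a *\<^sub>R axis 1 1 + b *\<^sub>R axis 2 1 + c *\<^sub>R (axis 3 1 :: real^3)"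
    for a b c :: real
    by (simp add: vec_eq_iff forall_3 axis_def)
  have lin: "linear D" using D has_derivative_linear by auto
  have X0: "X ?x \<bullet> ?x = 0"
    using tangent[OF S] by (simp add: tangent_space_def outward_normal_def)

  have "(sphere_point l has_vector_derivative ?f) (at p)"
    unfolding sphere_point_def[abs_def] i_lat_def vec
    by (auto intro!: derivative_eq_intros simp: algebra_simps)
  from has_derivative_along_curve[OF D this S]
  have X1: "((\<lambda>q. X (sphere_point l q)) has_vector_derivative D ?f) (at p)" .
  have "(i_lat l has_vector_derivative - ?x) (at p)"
    unfolding sphere_point_def[abs_def] i_lat_def[abs_def] vec
    by (auto intro!: derivative_eq_intros simp: algebra_simps)
  from bounded_bilinear.has_vector_derivative[OF bounded_bilinear_inner X1 this]
  have "((\<lambda>q. X (sphere_point l q) \<bullet> i_lat l q) has_real_derivative D ?f \<bullet> ?f) (at p)"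
    by (simp add: has_real_derivative_iff_has_vector_derivative X0)
  from DERIV_mult[OF this DERIV_cos]
  have A: "deriv (\<lambda>q. (X (sphere_point l q) \<bullet> i_lat l q) * cos q) p
      = (D ?f \<bullet> ?f) * cos p - sin p * (X ?x \<bullet> ?f)"
    by (auto dest!: DERIV_imp_deriv simp: algebra_simps)

  have "((\<lambda>k. sphere_point k p) has_vector_derivative cos p *\<^sub>R ?e) (at l)"
    unfolding sphere_point_def[abs_def] i_lon_def vec
    by (auto intro!: derivative_eq_intros simp: algebra_simps)
  from has_derivative_along_curve[OF D this S]
  have X2: "((\<lambda>k. X (sphere_point k p)) has_vector_derivative cos p *\<^sub>R D ?e) (at l)"
    by (simp add: linear_scale[OF lin])
  have "(i_lon has_vector_derivative vector [- cos l, - sin l, 0]) (at l)"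
    unfolding i_lon_def[abs_def] vec
    by (auto intro!: derivative_eq_intros simp: algebra_simps)
  moreover have "vector [- cos l, - sin l, 0] = sin p *\<^sub>R ?f - cos p *\<^sub>R ?x"
  proof -
    have "- cos l = sin p * (- sin p * cos l) - cos p * (cos p * cos l)"
      "- sin l = sin p * (- sin p * sin l) - cos p * (cos p * sin l)"
      using sin_cos_squared_add3[of p] by algebra+
    then show ?thesis
      by (simp add: vec_eq_iff forall_3 sphere_point_def i_lat_def)
  qed
  ultimately have "(i_lon has_vector_derivative sin p *\<^sub>R ?f - cos p *\<^sub>R ?x) (at l)"
    by simp
  from bounded_bilinear.has_vector_derivative[OF bounded_bilinear_inner X2 this]
  have "((\<lambda>k. X (sphere_point k p) \<bullet> i_lon k) has_real_derivative
      sin p * (X ?x \<bullet> ?f) + cos p * (D ?e \<bullet> ?e)) (at l)"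
    by (simp add: has_real_derivative_iff_has_vector_derivative X0 inner_simps)
  then have B: "deriv (\<lambda>k. X (sphere_point k p) \<bullet> i_lon k) l
      = sin p * (X ?x \<bullet> ?f) + cos p * (D ?e \<bullet> ?e)"
    by (rule DERIV_imp_deriv)
  show ?thesis
    unfolding tangential_div_frame[OF D S] A B using p by (simp add: field_simps)
qed

end

(* For fixed v the field x \<mapsto> x \<times> \<Phi> v is the restriction of a linear map that is skew
   (w \<bullet> (w \<times> a) = 0), and compressing a skew map to the tangent plane keeps it skew, so the
   trace defining the divergence vanishes. *)
theory Submission
  imports Defs
begin

lemma tangent_proj_in_tangent_space:
  assumes "x \<in> unit_sphere"
  shows "tangent_proj x w \<in> tangent_space x"
  using assms
  by (simp add: tangent_proj_def tangent_space_def outward_normal_def inner_simps dot_square_norm)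

text \<open>Moves the outer projection of \<open>covariant_deriv\<close> onto the other factor of an
  inner product.\<close>

lemma tangent_proj_self_adjoint: "u \<bullet> tangent_proj x w = tangent_proj x u \<bullet> w"
  by (simp add: tangent_proj_def inner_simps inner_commute)

text \<open>Skewness at tangent vectors suffices: the divergence sees \<open>D\<close> only through
  its compression to the tangent plane, where any two derivatives within the sphere agree.\<close>

lemma tangential_div_skew:
  assumes D: "(X has_derivative D) (at x within unit_sphere)"
    and x: "x \<in> unit_sphere"
    and skew: "\<And>w. w \<in> tangent_space x \<Longrightarrow> w \<bullet> D w = 0"
  shows "tangential_div X x = 0"
proof -
  have "w \<bullet> covariant_deriv X x (tangent_proj x w) = 0" for w
    using tangent_proj_in_tangent_space[OF x]
    by (simp add: covariant_deriv_eq[OF D x] tangent_proj_self_adjoint skew)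
  \<comment> \<open>At basis vectors the quadratic form gives the diagonal entries of the matrix, so
    each term of the trace is zero.\<close>
  from this[of "axis _ 1"] show ?thesis
    by (simp add: tangential_div_def trace_def matrix_def inner_axis')
qed

theorem claim2p1:
  fixes \<Phi> :: "real \<Rightarrow> real^3"
    and F :: "real^3 \<Rightarrow> real \<Rightarrow> real^3"
  assumes "\<And>x u. x \<in> unit_sphere \<Longrightarrow> F x u = outward_normal x \<times> \<Phi> u"
  shows "flux_vector F \<and> geometry_compatible F"
proof
  show "flux_vector F"
    by (simp add: flux_vector_def tangent_space_def assms outward_normal_def dot_cross_self)
  \<comment> \<open>\<open>F\<close> is prescribed only on the sphere, so its derivative there is
    transferred from the linear map \<open>\<lambda>y. y \<times> \<Phi> v\<close>, which is its own
    derivative.\<close>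
  have D: "((\<lambda>y. F y v) has_derivative (\<lambda>w. w \<times> \<Phi> v)) (at x within unit_sphere)"
    if x: "x \<in> unit_sphere" for x v
  proof (rule has_derivative_transform[OF x])
    show "((\<lambda>y. y \<times> \<Phi> v) has_derivative (\<lambda>w. w \<times> \<Phi> v)) (at x within unit_sphere)"
      by (intro bounded_linear_imp_has_derivative bounded_bilinear.bounded_linear_left
          bilinear_cross[unfolded bilinear_conv_bounded_bilinear])
  qed (simp add: assms outward_normal_def)
  show "geometry_compatible F"
    unfolding geometry_compatible_def
    by (intro allI ballI conjI differentiableI[OF D] tangential_div_skew[OF D])
      (simp_all add: dot_cross_self)
qed

end
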